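(* Let $n\ge 5$ be an odd integer with $n\notin\{5,7,9,13,17,27,33\}$, and $R_n^4=\langle (n-1)^4,n^4,(n+1)^4\rangle$. The matrix of minimal relations $\mathcal{A}$ of $R_n^4$ (with respect to $d_1=(n-1)^4$, $d_2=n^4$, $d_3=(n+1)^4$) is as follows. $n=20m+1$, $m\ge 1$: $$\begin{pmatrix}230m^2+30m+1&-32m(5m-1)&-2m(35m+1)\\-10m(15m+1)&16(50m^2+10m+1)&-(650m^2+50m+1)\\-(80m^2+20m+1)&-16(40m^2+12m+1)&720m^2+52m+1\end{pmatrix}$$ $n=20m+3$, $m\ge 1$: $$\begin{pmatrix}530m^2+178m+15&-16(10m^2-6m-1)&-(370m^2+94m+6)\\-(60m^2+16m+1)&16(20m^2+8m+1)&-(260m^2+72m+5)\\-(470m^2+162m+14)&-32(5m^2+7m+1)&630m^2+166m+11\end{pmatrix}$$ $n=20m+5$, $m\ge 1$: $$\begin{pmatrix}490m^2+258m+34&-16(30m^2+10m+1)&-(10m^2-2m-1)\\-(320m^2+164m+21)&16(40m^2+20m+3)&-(320m^2+156m+19)\\-(170m^2+94m+13)&-32(5m^2+5m+1)&330m^2+154m+18\end{pmatrix}$$ $n=20m+7$, $m\ge 2$: $$\begin{pmatrix}2(565m^2+417m+77)&-32(5m^2-7m-3)&-(970m^2+638m+105)\\-(130m^2+94m+17)&16(10m^2+6m+1)&-(30m^2+22m+4)\\-(1000m^2+740m+137)&-16(20m+7)&1000m^2+660m+109\end{pmatrix}$$ $n=20m+9$, $m\ge 1$: $$\begin{pmatrix}430m^2+402m+94&-16(10m^2+2m-1)&-(270m^2+230m+49)\\-(290m^2+266m+61)&32(15m^2+13m+3)&-(190m^2+170m+38)\\-(140m^2+136m+33)&-16(20m^2+24m+7)&460m^2+400m+87\end{pmatrix}$$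 $n=20m-9$, $m\ge 1$: $$\begin{pmatrix}460m^2-400m+87&-16(20m^2-24m+7)&-(140m^2-136m+33)\\-(190m^2-170m+38)&32(15m^2-13m+3)&-(290m^2-266m+61)\\-(270m^2-230m+49)&-16(10m^2-2m-1)&430m^2-402m+94\end{pmatrix}$$ $n=20m-7$, $m\ge 3$: $$\begin{pmatrix}1030m^2-682m+113&-32(5m^2-13m+4)&-(870m^2-646m+120)\\-(30m^2-22m+4)&16(10m^2-6m+1)&-(130m^2-94m+17)\\-(1000m^2-660m+109)&-16(20m-7)&1000m^2-740m+137\end{pmatrix}$$ $n=20m-5$, $m\ge 1$: $$\begin{pmatrix}330m^2-154m+18&-32(5m^2-5m+1)&-(170m^2-94m+13)\\-(320m^2-156m+19)&16(40m^2-20m+3)&-(320m^2-164m+21)\\-(10m^2+2m-1)&-16(30m^2-10m+1)&490m^2-258m+34\end{pmatrix}$$ $n=20m-3$, $m\ge 2$: $$\begin{pmatrix}630m^2-166m+11&-32(5m^2-7m+1)&-(470m^2-162m+14)\\-(260m^2-72m+5)&16(20m^2-8m+1)&-(60m^2-16m+1)\\-(370m^2-94m+6)&-16(10m^2+6m-1)&530m^2-178m+15\end{pmatrix}$$ $n=20m-1$, $m\ge 1$: $$\begin{pmatrix}720m^2-52m+1&-16(40m^2-12m+1)&-(80m^2-20m+1)\\-(650m^2-50m+1)&16(50m^2-10m+1)&-10m(15m-1)\\-2m(35m-1)&-32m(5m+1)&230m^2-30m+1\end{pmatrix}$$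
   Context: For positive integers $d_1,d_2,d_3$ with $\gcd(d_1,d_2,d_3)=1$, $S=\langle d_1,d_2,d_3\rangle=\{x_1d_1+x_2d_2+x_3d_3 : x_i\in\mathbb{Z}_{\ge 0}\}$ is the numerical semigroup they generate; $F(S)$ denotes the largest integer not in $S$, and $S$ is symmetric if for every integer $s$ exactly one of $s,F(S)-s$ lies in $S$. For a nonsymmetric $S=\langle d_1,d_2,d_3\rangle$, the matrix of minimal relations is the integer matrix $$\mathcal{A}=\begin{pmatrix}a_{11}&-a_{12}&-a_{13}\\-a_{21}&a_{22}&-a_{23}\\-a_{31}&-a_{32}&a_{33}\end{pmatrix},\qquad a_{ij}\in\mathbb{Z}_{\ge 0},$$ such that $\mathcal{A}(d_1,d_2,d_3)^{T}=0$, the greatest common divisor of the entries of each row is $1$, and for each $i$, with $\{i,j,k\}=\{1,2,3\}$, $a_{ii}=\min\{v\ge 2 : v\,d_i=v_jd_j+v_kd_k \text{ for some } v_j,v_k\in\mathbb{Z}_{\ge 0}\}$. (For nonsymmetric $S$ it is unique.) The semigroups $R_n^4$ with $n$ odd, $n\ge 9$, are nonsymmetric. *)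

theory Defs
  imports "HOL-Analysis.Analysis"
begin

definition semigroup_gen3 :: "int ^ 3 \<Rightarrow> int set" where
  "semigroup_gen3 d = {x1 * d $ 1 + x2 * d $ 2 + x3 * d $ 3 | x1 x2 x3. 0 \<le> x1 \<and> 0 \<le> x2 \<and> 0 \<le> x3}"

(* The Frobenius number is an integer (it is -1 if every natural number is in S). GREATEST is
   meaningful only if the integers outside S are bounded above, as for a numerical semigroup. *)
definition frobenius_number :: "int set \<Rightarrow> int" where
  "frobenius_number S = (GREATEST s. s \<notin> S)"

definition symmetric_semigroup :: "int set \<Rightarrow> bool" where
  "symmetric_semigroup S \<longleftrightarrow> (\<forall>s. (s \<in> S) \<noteq> (frobenius_number S - s \<in> S))"

(* The signed entries are stored, so a_ij is - A $ i $ j off the diagonal.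
   The first three conjuncts are the standing assumptions on d under which the notion is
   defined: positive, relatively prime generators of a nonsymmetric semigroup.  They also
   make the set under LEAST nonempty. *)
definition is_minimal_relations_matrix :: "int ^ 3 \<Rightarrow> int ^ 3 ^ 3 \<Rightarrow> bool" where
  "is_minimal_relations_matrix d A \<longleftrightarrow>
     (\<forall>i. 0 < d $ i) \<and>
     Gcd (range (\<lambda>i. d $ i)) = 1 \<and>
     \<not> symmetric_semigroup (semigroup_gen3 d) \<and>
     (\<forall>i. 0 \<le> A $ i $ i) \<and>
     (\<forall>i j. i \<noteq> j \<longrightarrow> A $ i $ j \<le> 0) \<and>
     A *v d = 0 \<and>
     (\<forall>i. Gcd (range (\<lambda>j. A $ i $ j)) = 1) \<and>
     (\<forall>i j k. {i, j, k} = UNIV \<longrightarrow>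
        A $ i $ i = (LEAST v. 2 \<le> v \<and>
          (\<exists>vj vk. 0 \<le> vj \<and> 0 \<le> vk \<and> v * d $ i = vj * d $ j + vk * d $ k)))"

definition R4_gens :: "int \<Rightarrow> int ^ 3" where
  "R4_gens n = vector [(n - 1) ^ 4, n ^ 4, (n + 1) ^ 4]"

end

(* Herzog: if the off-diagonal entries of A are negative, its columns sum to zero and the cross
   product of its first two rows is the primitive vector d, then A is the matrix of minimal
   relations of d.  Any two rows span the lattice of relations of d; since the rows sum to zero,
   every relation is a nonnegative combination of the rows with at least one vanishing coefficient.
   The sign patterns of such combinations yield minimality and uniqueness, and they show that the
   two corners of the L-shaped Apery set give distinct pseudo-Frobenius numbers, which rules out
   symmetry.  For the powers (n-1)^4, n^4, (n+1)^4 the hypotheses are polynomial identities and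
   inequalities in m. *)
theory Submission
  imports Defs
begin

section \<open>Orderings of the three indices and Bezout coefficients\<close>

lemma UNIV_3_distinct:
  assumes "{i, j, k} = (UNIV :: 3 set)"
  shows "i \<noteq> j" "i \<noteq> k" "j \<noteq> k"
proof -
  have "card {i, j, k} = 3" by (simp add: assms)
  then show "i \<noteq> j" "i \<noteq> k" "j \<noteq> k"
    by (auto simp: card_insert_if split: if_splits)
qed

lemma sum_UNIV_3:
  fixes f :: "3 \<Rightarrow> 'a::comm_monoid_add"
  assumes "{i, j, k} = (UNIV :: 3 set)"
  shows "sum f UNIV = f i + f j + f k"
  using UNIV_3_distinct[OF assms] by (simp flip: assms add: add.assoc)

lemma ex_UNIV_3:
  fixes i :: 3
  obtains j k where "{i, j, k} = (UNIV :: 3 set)"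
proof -
  have "{1, 2, 3} = (UNIV :: 3 set)" "{2, 1, 3} = (UNIV :: 3 set)" "{3, 1, 2} = (UNIV :: 3 set)"
    using UNIV_3 by auto
  then show ?thesis using that exhaust_3[of i] by metis
qed

lemma Gcd_range_3:
  fixes f :: "3 \<Rightarrow> int"
  shows "Gcd (range f) = gcd (f 1) (gcd (f 2) (f 3))"
  by (simp add: UNIV_3)

lemma bezout_3:
  fixes a b c :: int
  assumes "gcd a (gcd b c) = 1"
  obtains r s t where "r * a + s * b + t * c = 1"
proof -
  obtain s t where "s * b + t * c = gcd b c" using bezout_int by blast
  moreover obtain u v where "u * a + v * gcd b c = 1" using bezout_int assms by metis
  ultimately have "u * a + (v * s) * b + (v * t) * c = 1" by (metis add.assoc distrib_left mult.assoc)
  then show ?thesis by (rule that)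
qed

section \<open>Pseudo-Frobenius numbers of symmetric semigroups\<close>

text \<open>If \<open>f\<close> differed from the Frobenius number \<open>F\<close>, then
  \<open>F - f\<close> would be a nonzero element of the semigroup, hence a generator
  \<open>d $ i\<close> plus an element. Adding \<open>f + d $ i\<close> to that element would put
  \<open>F\<close> into the semigroup. Nonsymmetry thus follows from two distinct such
  \<open>f\<close>.\<close>

lemma symmetric_pseudo_frobenius_unique:
  assumes sym: "symmetric_semigroup (semigroup_gen3 d)"
    and f: "f \<notin> semigroup_gen3 d" "\<And>i. f + d $ i \<in> semigroup_gen3 d"
  shows "f = frobenius_number (semigroup_gen3 d)"
proof (rule ccontr)
  let ?S = "semigroup_gen3 d" and ?F = "frobenius_number (semigroup_gen3 d)"
  assume ne: "f \<noteq> ?F"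
  have add: "x + y \<in> ?S" if "x \<in> ?S" "y \<in> ?S" for x y
  proof -
    obtain a b c where x: "x = a * d $ 1 + b * d $ 2 + c * d $ 3" "0 \<le> a" "0 \<le> b" "0 \<le> c"
      using \<open>x \<in> ?S\<close> unfolding semigroup_gen3_def by auto
    obtain a' b' c' where y: "y = a' * d $ 1 + b' * d $ 2 + c' * d $ 3" "0 \<le> a'" "0 \<le> b'" "0 \<le> c'"
      using \<open>y \<in> ?S\<close> unfolding semigroup_gen3_def by auto
    have "x + y = (a + a') * d $ 1 + (b + b') * d $ 2 + (c + c') * d $ 3"
      by (simp add: x y algebra_simps)
    then show ?thesis unfolding semigroup_gen3_def using x y by fastforce
  qed
  have "0 \<in> ?S" unfolding semigroup_gen3_def by force
  \<comment> \<open>This is symmetry at \<open>s = 0\<close>.\<close>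
  then have F: "?F \<notin> ?S" using sym unfolding symmetric_semigroup_def by (metis diff_zero)
  have "?F - f \<in> ?S" using sym f(1) unfolding symmetric_semigroup_def by blast
  then obtain a b c where s: "?F - f = a * d $ 1 + b * d $ 2 + c * d $ 3" "0 \<le> a" "0 \<le> b" "0 \<le> c"
    unfolding semigroup_gen3_def by auto
  have gen: "a * d $ 1 + b * d $ 2 + c * d $ 3 \<in> ?S" if "0 \<le> a" "0 \<le> b" "0 \<le> c" for a b c
    using that unfolding semigroup_gen3_def by blast
  have "\<not> (a = 0 \<and> b = 0 \<and> c = 0)" using s(1) ne by auto
  then have "a > 0 \<or> b > 0 \<or> c > 0" using s(2-4) by linarith
  then obtain i where "?F - f - d $ i \<in> ?S"
  proof (elim disjE)
    assume "a > 0"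
    then have "?F - f - d $ 1 \<in> ?S" using gen[of "a - 1" b c] s by (simp add: algebra_simps)
    then show ?thesis by (rule that)
  next
    assume "b > 0"
    then have "?F - f - d $ 2 \<in> ?S" using gen[of a "b - 1" c] s by (simp add: algebra_simps)
    then show ?thesis by (rule that)
  next
    assume "c > 0"
    then have "?F - f - d $ 3 \<in> ?S" using gen[of a b "c - 1"] s by (simp add: algebra_simps)
    then show ?thesis by (rule that)
  qed
  from add[OF f(2)[of i] this] have "?F \<in> ?S" by (simp add: algebra_simps)
  with F show False ..
qed

section \<open>Nonnegative combinations of two rows\<close>

text \<open>Here \<open>(t, p)\<close> and \<open>(r, u)\<close> are the entries of rows i and j in
  columns i and j, while \<open>s\<close> and \<open>q\<close> are the entries of the remaining row
  in these columns. Nonpositivity in column j forces \<open>b < a\<close>, and then column i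
  contains at least one full copy of \<open>t\<close>.\<close>

lemma two_row_bound:
  fixes a b p q r s t u :: int
  assumes neg: "p < 0" "q < 0" "r < 0" "s < 0"
    and diag: "t + r + s = 0" "u + p + q = 0"
    and "0 \<le> a" "0 \<le> b"
    and pos: "0 < a * t + b * r" and nonpos: "a * p + b * u \<le> 0"
  shows "t \<le> a * t + b * r" "a * t + b * r = t \<Longrightarrow> a = 1 \<and> b = 0"
proof -
  have t: "t = - r - s" and u: "u = - p - q" using diag by auto
  have "b * r \<le> 0" using \<open>0 \<le> b\<close> neg by (simp add: mult_nonneg_nonpos)
  with pos have "0 < a * t" by simp
  then have "a > 0" using \<open>0 \<le> a\<close> by (cases "a = 0") auto
  have "b < a"
  proof (rule ccontr)
    assume "\<not> b < a"
    then have "(a - b) * p \<ge> 0" using neg by (simp add: mult_nonpos_nonpos)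
    moreover have "b * q < 0" using \<open>0 < a\<close> \<open>\<not> b < a\<close> neg by (simp add: mult_pos_neg)
    ultimately show False using nonpos by (simp add: u algebra_simps)
  qed
  \<comment> \<open>Substituting \<open>r = - t - s\<close> leaves two nonnegative terms. Since
    \<open>t\<close> and \<open>- s\<close> are positive, equality forces \<open>b = 0\<close> and
    then \<open>a = 1\<close>.\<close>
  have eq: "a * t + b * r - t = (a - 1 - b) * t + b * (- s)"
    by (simp add: t algebra_simps)
  have "t > 0" using t neg by simp
  have g: "(a - 1 - b) * t \<ge> 0" "b * (- s) \<ge> 0"
    using \<open>b < a\<close> \<open>t > 0\<close> \<open>0 \<le> b\<close> neg by (simp_all add: mult_nonneg_nonpos)
  with eq show "t \<le> a * t + b * r" by linarith
  assume "a * t + b * r = t"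
  with eq g have "(a - 1 - b) * t = 0" "b * (- s) = 0" by linarith+
  with \<open>t > 0\<close> neg show "a = 1 \<and> b = 0" by auto
qed

section \<open>Herzog's criterion for the matrix of minimal relations\<close>

text \<open>These conditions can be checked on explicit formulas; positivity of \<open>d\<close>,
  minimality, row gcds and nonsymmetry are derived from them. By \<open>cross\<close> and
  \<open>primitive\<close>, rows 1 and 2 form a basis of the lattice of relations.\<close>

locale herzog_matrix =
  fixes A :: "int ^ 3 ^ 3" and d :: "int ^ 3"
  assumes neg: "i \<noteq> j \<Longrightarrow> A $ i $ j < 0"
    and column_sum: "(\<Sum>i\<in>UNIV. A $ i $ j) = 0"
    and cross: "d $ 1 = A$1$2 * A$2$3 - A$1$3 * A$2$2"
      "d $ 2 = A$1$3 * A$2$1 - A$1$1 * A$2$3"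
      "d $ 3 = A$1$1 * A$2$2 - A$1$2 * A$2$1"
    and primitive: "Gcd (range (\<lambda>i. d $ i)) = 1"
begin

lemma column_sum': "{i, j, k} = (UNIV :: 3 set) \<Longrightarrow> A $ i $ l + A $ j $ l + A $ k $ l = 0"
  using column_sum[of l] by (simp add: sum_UNIV_3)

lemma row3: "A $ 3 $ j = - A $ 1 $ j - A $ 2 $ j"
  using column_sum'[of 1 2 3 j] UNIV_3 by simp

text \<open>The column sum makes the diagonal entry a sum of two positive integers. This is the
  lower bound imposed in the definition of the minimum.\<close>

lemma diag_ge_2: "2 \<le> A $ i $ i"
proof -
  obtain j k where ijk: "{i, j, k} = (UNIV :: 3 set)" by (rule ex_UNIV_3)
  then show ?thesis
    using column_sum'[OF ijk, of i] neg[of j i] neg[of k i] UNIV_3_distinct[OF ijk] by simp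
qed

lemma generators_pos: "0 < d $ i"
proof -
  have "0 < d $ 1"
    using neg[of 1 2] neg[of 2 3] neg[of 1 3] diag_ge_2[of 2]
    by (simp add: cross add_strict_increasing2 mult_neg_neg mult_neg_pos less_trans[of _ 0])
  moreover have "0 < d $ 2"
    using neg[of 2 1] neg[of 2 3] neg[of 1 3] diag_ge_2[of 1]
    by (simp add: cross mult_neg_neg mult_pos_neg less_trans[of _ 0])
  moreover have "0 < d $ 3"
  proof -
    \<comment> \<open>The formula in \<open>cross\<close> is a difference of two positive products.
      Eliminating row 2 by the column sums turns it into a sum of positive ones.\<close>
    have "d $ 3 = A$1$1 * (- A$3$2) + A$1$2 * A$3$1"
      unfolding cross row3 by (simp add: algebra_simps)
    moreover have "0 < A$1$1 * (- A$3$2)" "0 < A$1$2 * A$3$1"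
      using neg[of 3 2] neg[of 3 1] neg[of 1 2] diag_ge_2[of 1]
      by (simp_all add: mult_neg_neg mult_pos_neg)
    ultimately show ?thesis by linarith
  qed
  ultimately show ?thesis using exhaust_3[of i] by metis
qed

lemma relations: "A $ i $ 1 * d $ 1 + A $ i $ 2 * d $ 2 + A $ i $ 3 * d $ 3 = 0"
  using exhaust_3[of i] by (elim disjE) (simp_all add: cross row3 algebra_simps)

text \<open>Primitivity makes the coefficients integers: a Bezout vector completes the first two
  rows to a matrix of determinant 1. The relation among the three rows then allows a shift to
  nonnegative coefficients.\<close>

lemma relation_combination:
  assumes "z1 * d $ 1 + z2 * d $ 2 + z3 * d $ 3 = 0"
  obtains c :: "int ^ 3" and l where "\<And>i. 0 \<le> c $ i" "c $ l = 0"
    "z1 = (\<Sum>i\<in>UNIV. c $ i * A $ i $ 1)" "z2 = (\<Sum>i\<in>UNIV. c $ i * A $ i $ 2)"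
    "z3 = (\<Sum>i\<in>UNIV. c $ i * A $ i $ 3)"
proof -
  obtain s1 s2 s3 where s: "s1 * d $ 1 + s2 * d $ 2 + s3 * d $ 3 = 1"
    using bezout_3 primitive unfolding Gcd_range_3 by metis
  (* Cramer's rule: det(r1,r2,s) z = det(z,r2,s) r1 + det(r1,z,s) r2 + det(r1,r2,z) s,
     with det(r1,r2,s) = s . d = 1 and det(r1,r2,z) = z . d = 0. *)
  define \<alpha> where "\<alpha> = s1 * (z2 * A$2$3 - z3 * A$2$2) + s2 * (z3 * A$2$1 - z1 * A$2$3)
    + s3 * (z1 * A$2$2 - z2 * A$2$1)"
  define \<beta> where "\<beta> = s1 * (A$1$2 * z3 - A$1$3 * z2) + s2 * (A$1$3 * z1 - A$1$1 * z3)
    + s3 * (A$1$1 * z2 - A$1$2 * z1)"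
  have cramer: "z1 * (s1 * d $ 1 + s2 * d $ 2 + s3 * d $ 3) =
      \<alpha> * A$1$1 + \<beta> * A$2$1 + (z1 * d $ 1 + z2 * d $ 2 + z3 * d $ 3) * s1"
    "z2 * (s1 * d $ 1 + s2 * d $ 2 + s3 * d $ 3) =
      \<alpha> * A$1$2 + \<beta> * A$2$2 + (z1 * d $ 1 + z2 * d $ 2 + z3 * d $ 3) * s2"
    "z3 * (s1 * d $ 1 + s2 * d $ 2 + s3 * d $ 3) =
      \<alpha> * A$1$3 + \<beta> * A$2$3 + (z1 * d $ 1 + z2 * d $ 2 + z3 * d $ 3) * s3"
    unfolding cross \<alpha>_def \<beta>_def by algebra+
  \<comment> \<open>As the rows sum to zero, subtracting a constant from the coefficients
    \<open>(\<alpha>, \<beta>, 0)\<close> changes nothing. Subtracting the least of them makes all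
    nonnegative and one zero.\<close>
  define \<mu> where "\<mu> = min (min \<alpha> \<beta>) 0"
  define c :: "int ^ 3" where "c = vector [\<alpha> - \<mu>, \<beta> - \<mu>, - \<mu>]"
  have c: "c $ 1 = \<alpha> - \<mu>" "c $ 2 = \<beta> - \<mu>" "c $ 3 = - \<mu>"
    by (simp_all add: c_def)
  have nonneg: "\<forall>i. 0 \<le> c $ i" unfolding forall_3 c \<mu>_def by auto
  have "c $ 1 = 0 \<or> c $ 2 = 0 \<or> c $ 3 = 0" unfolding c \<mu>_def by linarith
  then obtain l where l: "c $ l = 0" by blast
  have "z1 = (\<Sum>i\<in>UNIV. c $ i * A $ i $ 1)" "z2 = (\<Sum>i\<in>UNIV. c $ i * A $ i $ 2)"
    "z3 = (\<Sum>i\<in>UNIV. c $ i * A $ i $ 3)"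
    using cramer unfolding s assms sum_3 c row3 by (simp_all add: algebra_simps)
  then show ?thesis using nonneg l by (intro that[of c l]) blast+
qed

text \<open>The sum over all indices does not depend on their order, so the decomposition holds for
  any labelling and one argument serves every row.\<close>

lemma relation_combination_perm:
  assumes ijk: "{i, j, k} = (UNIV :: 3 set)"
    and z: "zi * d $ i + zj * d $ j + zk * d $ k = 0"
  obtains c where "\<And>l. 0 \<le> c l" "c i = 0 \<or> c j = 0 \<or> c k = 0"
    "zi = c i * A$i$i + c j * A$j$i + c k * A$k$i"
    "zj = c i * A$i$j + c j * A$j$j + c k * A$k$j"
    "zk = c i * A$i$k + c j * A$j$k + c k * A$k$k"
proof -
  note dist = UNIV_3_distinct[OF ijk]
  define z where "z = (\<lambda>l. if l = i then zi else if l = j then zj else zk)"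
  have zv: "z i = zi" "z j = zj" "z k = zk" using dist by (auto simp: z_def)
  have "(\<Sum>l\<in>UNIV. z l * d $ l) = 0" using z by (simp add: sum_UNIV_3[OF ijk] zv)
  then have "z 1 * d $ 1 + z 2 * d $ 2 + z 3 * d $ 3 = 0" by (simp add: sum_3)
  then obtain c :: "int ^ 3" and l where c: "\<And>i. 0 \<le> c $ i" "c $ l = 0"
    "z 1 = (\<Sum>i\<in>UNIV. c $ i * A $ i $ 1)" "z 2 = (\<Sum>i\<in>UNIV. c $ i * A $ i $ 2)"
    "z 3 = (\<Sum>i\<in>UNIV. c $ i * A $ i $ 3)"
    by (rule relation_combination) blast
  then have "\<forall>p. z p = (\<Sum>i\<in>UNIV. c $ i * A $ i $ p)" unfolding forall_3 by blast
  then have "z p = c $ i * A$i$p + c $ j * A$j$p + c $ k * A$k$p" for p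
    by (simp add: sum_UNIV_3[OF ijk])
  moreover have "l \<in> {i, j, k}" using ijk by simp
  then have "c $ i = 0 \<or> c $ j = 0 \<or> c $ k = 0" using c(2) by auto
  ultimately show ?thesis using that[of "\<lambda>l. c $ l"] c(1) zv by metis
qed

text \<open>Some coefficient of the decomposition vanishes. It is not that of row i, since the other
  rows are negative in column i. So only row i and one other row occur, and
  \<open>two_row_bound\<close> applies to the two matching columns; equality leaves exactly row
  i.\<close>

lemma minimal_relation:
  assumes ijk: "{i, j, k} = (UNIV :: 3 set)"
    and rel: "zi * d $ i + zj * d $ j + zk * d $ k = 0"
    and sgn: "0 < zi" "zj \<le> 0" "zk \<le> 0"
  shows "A $ i $ i \<le> zi" "zi = A $ i $ i \<Longrightarrow> zj = A $ i $ j \<and> zk = A $ i $ k"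
proof -
  note dist = UNIV_3_distinct[OF ijk]
  obtain c where c: "\<And>l. 0 \<le> c l" "c i = 0 \<or> c j = 0 \<or> c k = 0"
    and z: "zi = c i * A$i$i + c j * A$j$i + c k * A$k$i"
    "zj = c i * A$i$j + c j * A$j$j + c k * A$k$j"
    "zk = c i * A$i$k + c j * A$j$k + c k * A$k$k"
    using relation_combination_perm[OF ijk rel] by metis
  have n: "A$i$j < 0" "A$i$k < 0" "A$j$i < 0" "A$k$i < 0" "A$j$k < 0" "A$k$j < 0"
    using neg dist by metis+
  have s: "A$i$i + A$j$i + A$k$i = 0" "A$i$i + A$k$i + A$j$i = 0"
    "A$j$j + A$i$j + A$k$j = 0" "A$k$k + A$i$k + A$j$k = 0"
    using column_sum'[OF ijk] by (simp_all add: algebra_simps)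
  have "A $ i $ i \<le> zi \<and> (zi = A $ i $ i \<longrightarrow> zj = A $ i $ j \<and> zk = A $ i $ k)"
    using c(2)
  proof (elim disjE)
    assume "c i = 0"
    moreover have "c j * A$j$i \<le> 0" "c k * A$k$i \<le> 0"
      using c(1) n by (simp_all add: mult_nonneg_nonpos)
    ultimately show ?thesis using z(1) sgn(1) by simp
  next
    assume "c k = 0"
    then show ?thesis
      using two_row_bound[OF n(1,6,3,4) s(1,3) c(1)[of i] c(1)[of j]] z sgn by auto
  next
    \<comment> \<open>The same argument with j and k exchanged.\<close>
    assume "c j = 0"
    then show ?thesis
      using two_row_bound[OF n(2,5,4,3) s(2,4) c(1)[of i] c(1)[of k]] z sgn by auto
  qed
  then show "A $ i $ i \<le> zi" "zi = A $ i $ i \<Longrightarrow> zj = A $ i $ j \<and> zk = A $ i $ k" by blast+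
qed

lemma relations_perm:
  assumes ijk: "{i, j, k} = (UNIV :: 3 set)"
  shows "A $ i $ i * d $ i = - A $ i $ j * d $ j + - A $ i $ k * d $ k"
proof -
  have "(\<Sum>l\<in>UNIV. A $ i $ l * d $ l) = 0" using relations[of i] by (simp add: sum_3)
  then show ?thesis unfolding sum_UNIV_3[OF ijk] by simp
qed

lemma diag_eq_Least:
  assumes ijk: "{i, j, k} = (UNIV :: 3 set)"
  shows "(LEAST v. 2 \<le> v \<and> (\<exists>vj vk. 0 \<le> vj \<and> 0 \<le> vk \<and> v * d $ i = vj * d $ j + vk * d $ k))
    = A $ i $ i"
proof (rule Least_equality)
  have "A $ i $ j < 0" "A $ i $ k < 0" using neg UNIV_3_distinct[OF ijk] by metis+
  then have "0 \<le> - A $ i $ j" "0 \<le> - A $ i $ k" by auto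
  then show "2 \<le> A $ i $ i \<and> (\<exists>vj vk. 0 \<le> vj \<and> 0 \<le> vk \<and>
      A $ i $ i * d $ i = vj * d $ j + vk * d $ k)"
    using diag_ge_2 relations_perm[OF ijk] by metis
next
  fix v
  assume "2 \<le> v \<and> (\<exists>vj vk. 0 \<le> vj \<and> 0 \<le> vk \<and> v * d $ i = vj * d $ j + vk * d $ k)"
  then obtain vj vk where v: "2 \<le> v" "0 \<le> vj" "0 \<le> vk" "v * d $ i = vj * d $ j + vk * d $ k"
    by blast
  then show "A $ i $ i \<le> v"
    using minimal_relation(1)[OF ijk, of v "- vj" "- vk"] by simp
qed

text \<open>Two distinct gaps \<open>f\<close> and \<open>g\<close>, each of which enters the
  semigroup on adding any generator, contradict
  \<open>symmetric_pseudo_frobenius_unique\<close>.\<close>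

lemma not_symmetric: "\<not> symmetric_semigroup (semigroup_gen3 d)"
proof
  assume sym: "symmetric_semigroup (semigroup_gen3 d)"
  let ?S = "semigroup_gen3 d"
  \<comment> \<open>In the coordinates of \<open>d $ 2\<close> and \<open>d $ 3\<close>, the Apery
    set of \<open>d $ 1\<close> is the rectangle with sides \<open>A$2$2\<close> and
    \<open>A$3$3\<close> without the quadrant starting at \<open>(- A$1$2, - A$1$3)\<close>. Its two
    outer corners, lowered by \<open>d $ 1\<close>, are \<open>f\<close> and
    \<open>g\<close>.\<close>
  define f where "f = (A$2$2 - 1) * d $ 2 + (- A$1$3 - 1) * d $ 3 - d $ 1"
  define g where "g = (- A$1$2 - 1) * d $ 2 + (A$3$3 - 1) * d $ 3 - d $ 1"
  have n: "A$1$2 < 0" "A$1$3 < 0" "A$2$1 < 0" "A$2$3 < 0" "A$3$1 < 0" "A$3$2 < 0"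
    by (simp_all add: neg)
  have diag: "A$1$1 = - A$2$1 - A$3$1" "A$2$2 = - A$1$2 - A$3$2" "A$3$3 = - A$1$3 - A$2$3"
    using row3 by simp_all
  have gen: "s \<in> ?S" if "s = a * d $ 1 + b * d $ 2 + c * d $ 3" "0 \<le> a" "0 \<le> b" "0 \<le> c" for s a b c
    using that unfolding semigroup_gen3_def by blast
  have U: "{1, 2, 3} = (UNIV :: 3 set)" using UNIV_3 by simp
  have "f + d $ 1 \<in> ?S"
    by (rule gen[of _ 0 "A$2$2 - 1" "- A$1$3 - 1"]) (use n diag in \<open>auto simp: f_def\<close>)
  \<comment> \<open>The added generator completes \<open>A$2$2\<close> copies of
    \<open>d $ 2\<close>, which row 2 exchanges for the other generators. The remaining cases use
    rows 1 and 3 likewise.\<close>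
  moreover have "f + d $ 2 \<in> ?S"
    by (rule gen[of _ "- A$2$1 - 1" 0 "- A$2$3 - A$1$3 - 1"])
      (use n relations[of 2] in \<open>auto simp: f_def algebra_simps\<close>)
  moreover have "f + d $ 3 \<in> ?S"
    by (rule gen[of _ "A$1$1 - 1" "A$2$2 + A$1$2 - 1" 0])
      (use n diag relations[of 1] in \<open>auto simp: f_def algebra_simps\<close>)
  ultimately have fS: "\<forall>i. f + d $ i \<in> ?S" unfolding forall_3 by blast
  have "g + d $ 1 \<in> ?S"
    by (rule gen[of _ 0 "- A$1$2 - 1" "A$3$3 - 1"]) (use n diag in \<open>auto simp: g_def\<close>)
  moreover have "g + d $ 2 \<in> ?S"
    by (rule gen[of _ "A$1$1 - 1" 0 "A$3$3 + A$1$3 - 1"])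
      (use n diag relations[of 1] in \<open>auto simp: g_def algebra_simps\<close>)
  moreover have "g + d $ 3 \<in> ?S"
    by (rule gen[of _ "- A$3$1 - 1" "- A$3$2 - A$1$2 - 1" 0])
      (use n relations[of 3] in \<open>auto simp: g_def algebra_simps\<close>)
  ultimately have gS: "\<forall>i. g + d $ i \<in> ?S" unfolding forall_3 by blast
  \<comment> \<open>Only row 1 has a positive entry in column 1.\<close>
  have first_pos: "c 1 > 0"
    if "\<And>l. 0 \<le> c l" "0 < c 1 * A$1$1 + c 2 * A$2$1 + c 3 * A$3$1" for c :: "3 \<Rightarrow> int"
  proof (rule ccontr)
    assume "\<not> c 1 > 0"
    then have "c 1 = 0" using that(1)[of 1] by linarith
    moreover have "c 2 * A$2$1 \<le> 0" "c 3 * A$3$1 \<le> 0"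
      using that(1) n by (simp_all add: mult_nonneg_nonpos)
    ultimately show False using that(2) by simp
  qed
  have le: "c * a \<le> a" if "a < 0" "0 < c" for a c :: int
    using that mult_right_mono_neg[of 1 c a] by simp
  have fnot: "f \<notin> ?S"
  proof
    assume "f \<in> ?S"
    then obtain x1 x2 x3 where x: "f = x1 * d $ 1 + x2 * d $ 2 + x3 * d $ 3" "0 \<le> x1" "0 \<le> x2" "0 \<le> x3"
      unfolding semigroup_gen3_def by auto
    \<comment> \<open>Membership of \<open>f\<close> yields a relation whose first entry is
      positive, whose second exceeds \<open>- A$2$2\<close> and whose third exceeds
      \<open>A$1$3\<close>.\<close>
    then have "(x1 + 1) * d $ 1 + (x2 - A$2$2 + 1) * d $ 2 + (x3 + A$1$3 + 1) * d $ 3 = 0"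
      by (simp add: f_def algebra_simps)
    then obtain c :: "3 \<Rightarrow> int" where c: "\<And>l. 0 \<le> c l" "c 1 = 0 \<or> c 2 = 0 \<or> c 3 = 0"
      and z: "x1 + 1 = c 1 * A$1$1 + c 2 * A$2$1 + c 3 * A$3$1"
      "x2 - A$2$2 + 1 = c 1 * A$1$2 + c 2 * A$2$2 + c 3 * A$3$2"
      "x3 + A$1$3 + 1 = c 1 * A$1$3 + c 2 * A$2$3 + c 3 * A$3$3"
      by (rule relation_combination_perm[OF U]) blast
    have c1: "c 1 > 0" by (rule first_pos) (use c z x in auto)
    then have l: "c 1 * A$1$2 \<le> A$1$2" "c 1 * A$1$3 \<le> A$1$3" using le n by simp_all
    have m: "c 2 * A$2$3 \<le> 0" using c(1) n by (simp add: mult_nonneg_nonpos)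
    \<comment> \<open>Without row 3, the third entry would be at most \<open>A$1$3\<close>.\<close>
    have "c 3 \<noteq> 0" using z(3) l(2) m x by auto
    with c c1 have "c 2 = 0" "c 3 > 0" using order.not_eq_order_implies_strict[of 0 "c 3"] by auto
    \<comment> \<open>Rows 1 and 3 both occur and row 2 does not, so the second entry is at most
      \<open>A$1$2 + A$3$2 = - A$2$2\<close>.\<close>
    then show False using z(2) l(1) le[OF n(6), of "c 3"] diag x by simp
  qed
  have gnot: "g \<notin> ?S"
  proof
    assume "g \<in> ?S"
    then obtain x1 x2 x3 where x: "g = x1 * d $ 1 + x2 * d $ 2 + x3 * d $ 3" "0 \<le> x1" "0 \<le> x2" "0 \<le> x3"
      unfolding semigroup_gen3_def by auto
    then have "(x1 + 1) * d $ 1 + (x2 + A$1$2 + 1) * d $ 2 + (x3 - A$3$3 + 1) * d $ 3 = 0"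
      by (simp add: g_def algebra_simps)
    then obtain c :: "3 \<Rightarrow> int" where c: "\<And>l. 0 \<le> c l" "c 1 = 0 \<or> c 2 = 0 \<or> c 3 = 0"
      and z: "x1 + 1 = c 1 * A$1$1 + c 2 * A$2$1 + c 3 * A$3$1"
      "x2 + A$1$2 + 1 = c 1 * A$1$2 + c 2 * A$2$2 + c 3 * A$3$2"
      "x3 - A$3$3 + 1 = c 1 * A$1$3 + c 2 * A$2$3 + c 3 * A$3$3"
      by (rule relation_combination_perm[OF U]) blast
    have c1: "c 1 > 0" by (rule first_pos) (use c z x in auto)
    then have l: "c 1 * A$1$2 \<le> A$1$2" "c 1 * A$1$3 \<le> A$1$3" using le n by simp_all
    have m: "c 3 * A$3$2 \<le> 0" using c(1) n by (simp add: mult_nonneg_nonpos)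
    \<comment> \<open>The mirror image of the argument for \<open>f\<close>: the second entry forces
      row 2 to occur, and the third is then at most \<open>A$1$3 + A$2$3 = - A$3$3\<close>.\<close>
    have "c 2 \<noteq> 0" using z(2) l(1) m x by auto
    with c c1 have "c 3 = 0" "c 2 > 0" using order.not_eq_order_implies_strict[of 0 "c 2"] by auto
    then show False using z(3) l(2) le[OF n(4), of "c 2"] diag x by simp
  qed
  have "f \<noteq> g"
  proof
    assume "f = g"
    then have "A$3$2 * d $ 2 = A$2$3 * d $ 3"
      by (simp add: f_def g_def diag algebra_simps)
    (* The relation A33 d3 = -A31 d1 - A32 d2 becomes one for (A33 + A23) d3, with a smaller
       multiple of d3. *)
    then have "(A$3$3 + A$2$3) * d $ 3 + A$3$1 * d $ 1 + 0 * d $ 2 = 0"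
      using relations[of 3] by (simp add: algebra_simps)
    moreover have "{3, 1, 2} = (UNIV :: 3 set)" using UNIV_3 by auto
    \<comment> \<open>The leading coefficient \<open>A$3$3 + A$2$3\<close> equals
      \<open>- A$1$3\<close> and is positive, as minimality requires.\<close>
    ultimately have "A$3$3 \<le> A$3$3 + A$2$3"
      using minimal_relation(1)[of 3 1 2 "A$3$3 + A$2$3" "A$3$1" 0] n diag by simp
    then show False using n by simp
  qed
  then show False
    using symmetric_pseudo_frobenius_unique[OF sym fnot] symmetric_pseudo_frobenius_unique[OF sym gnot]
      fS gS by simp
qed

text \<open>A common divisor of a row divides every 2 by 2 minor involving that row, hence every
  generator, and the generators are relatively prime.\<close>

lemma row_gcd: "Gcd (range (\<lambda>j. A $ i $ j)) = 1"
proof -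
  define g where "g = Gcd (range (\<lambda>j. A $ i $ j))"
  have g: "g dvd A $ i $ j" for j unfolding g_def by (simp add: Gcd_dvd)
  \<comment> \<open>Since row 3 is minus the sum of rows 1 and 2, the cross product of rows 2 and 3
    is again \<open>d\<close>. This covers the case of row 3.\<close>
  have d3: "d $ 1 = A$2$2 * A$3$3 - A$2$3 * A$3$2"
    "d $ 2 = A$2$3 * A$3$1 - A$2$1 * A$3$3"
    "d $ 3 = A$2$1 * A$3$2 - A$2$2 * A$3$1"
    unfolding cross row3 by (simp_all add: algebra_simps)
  have "g dvd d $ 1 \<and> g dvd d $ 2 \<and> g dvd d $ 3"
  proof (cases "i = 3")
    case True
    then have "g dvd A $ 3 $ j" for j using g by simp
    then show ?thesis unfolding d3 by simp
  next
    case False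
    then have "(\<forall>j. g dvd A $ 1 $ j) \<or> (\<forall>j. g dvd A $ 2 $ j)" using g exhaust_3[of i] by metis
    then show ?thesis unfolding cross by auto
  qed
  then have "g dvd Gcd (range (\<lambda>i. d $ i))" unfolding Gcd_range_3 by simp
  then have "is_unit g" unfolding primitive .
  moreover have "g \<ge> 0" unfolding g_def by simp
  ultimately show ?thesis unfolding g_def by simp
qed

theorem is_minimal_relations_matrix: "is_minimal_relations_matrix d A"
proof -
  have "A *v d = 0"
    unfolding matrix_vector_mult_def vec_eq_iff using relations by (simp add: sum_3)
  moreover have "0 \<le> A $ i $ i" for i using diag_ge_2[of i] by simp
  moreover have "\<forall>i j. i \<noteq> j \<longrightarrow> A $ i $ j \<le> 0" using neg less_imp_le by blast
  ultimately show ?thesis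
    unfolding is_minimal_relations_matrix_def
    using generators_pos primitive not_symmetric row_gcd diag_eq_Least by simp
qed

text \<open>The definition fixes the diagonal as a minimum. Each row of \<open>B\<close> is then a
  relation attaining it, and the equality case of \<open>minimal_relation\<close> determines the
  other entries.\<close>

theorem minimal_relations_matrix_unique:
  assumes "is_minimal_relations_matrix d B"
  shows "B = A"
proof -
  note B = assms[unfolded is_minimal_relations_matrix_def]
  have "B $ i $ l = A $ i $ l" for i l
  proof -
    obtain j k where ijk: "{i, j, k} = (UNIV :: 3 set)" by (rule ex_UNIV_3)
    note dist = UNIV_3_distinct[OF ijk]
    have Bii: "B $ i $ i = A $ i $ i" using B ijk diag_eq_Least[OF ijk] by simp
    have "(\<Sum>l\<in>UNIV. B $ i $ l * d $ l) = 0"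
      using B by (simp add: matrix_vector_mult_def vec_eq_iff)
    then have "B $ i $ i * d $ i + B $ i $ j * d $ j + B $ i $ k * d $ k = 0"
      unfolding sum_UNIV_3[OF ijk] .
    moreover have "0 < B $ i $ i" using Bii diag_ge_2[of i] by simp
    moreover have "B $ i $ j \<le> 0" "B $ i $ k \<le> 0" using B dist by blast+
    ultimately have "B $ i $ j = A $ i $ j" "B $ i $ k = A $ i $ k"
      using minimal_relation(2)[OF ijk _ _ _ _ Bii] by blast+
    moreover have "l \<in> {i, j, k}" using ijk by simp
    ultimately show ?thesis using Bii by auto
  qed
  then show ?thesis by (simp add: vec_eq_iff)
qed

end

section \<open>Fourth powers of three consecutive integers\<close>

text \<open>The consecutive integers \<open>n - 1\<close> and \<open>n\<close> are already
  coprime.\<close>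

lemma R4_gens_primitive: "Gcd (range (\<lambda>i. R4_gens n $ i)) = 1"
proof -
  have "coprime (n - 1) n" using coprime_diff_one_left by blast
  then have "coprime ((n - 1) ^ 4) (n ^ 4)" by simp
  then show ?thesis
    by (simp add: Gcd_range_3 R4_gens_def coprime_iff_gcd_eq_1 flip: gcd.assoc)
qed

text \<open>Reduces each residue class to six strict inequalities and six polynomial identities in
  the entries.\<close>

lemma R4_minimal_relations:
  fixes n a11 a12 a13 a21 a22 a23 a31 a32 a33 :: int
  defines "A \<equiv> vector [vector [a11, a12, a13], vector [a21, a22, a23], vector [a31, a32, a33]] :: int ^ 3 ^ 3"
  assumes "a12 < 0" "a13 < 0" "a21 < 0" "a23 < 0" "a31 < 0" "a32 < 0"
    and "a11 + a21 + a31 = 0" "a12 + a22 + a32 = 0" "a13 + a23 + a33 = 0"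
    and "a12 * a23 - a13 * a22 = (n - 1) ^ 4" "a13 * a21 - a11 * a23 = n ^ 4"
      "a11 * a22 - a12 * a21 = (n + 1) ^ 4"
  shows "is_minimal_relations_matrix (R4_gens n) A \<and> (\<exists>!A. is_minimal_relations_matrix (R4_gens n) A)"
proof -
  have "\<forall>i j. i \<noteq> j \<longrightarrow> A $ i $ j < 0" "\<forall>j. (\<Sum>i\<in>UNIV. A $ i $ j) = 0"
    using assms by (simp_all add: forall_3 sum_3)
  then interpret herzog_matrix A "R4_gens n"
    using assms R4_gens_primitive by unfold_locales (simp_all add: R4_gens_def)
  show ?thesis using is_minimal_relations_matrix minimal_relations_matrix_unique by blast
qed

section \<open>The odd residue classes modulo 20\<close>

lemma R4_plus_1:
  fixes m n :: int
  assumes "1 \<le> m" and n: "n = 20 * m + 1"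
  shows "is_minimal_relations_matrix (R4_gens n)
       (vector [vector [230 * m^2 + 30 * m + 1, - 32 * m * (5 * m - 1), - 2 * m * (35 * m + 1)],
               vector [- 10 * m * (15 * m + 1), 16 * (50 * m^2 + 10 * m + 1), - (650 * m^2 + 50 * m + 1)],
               vector [- (80 * m^2 + 20 * m + 1), - 16 * (40 * m^2 + 12 * m + 1), 720 * m^2 + 52 * m + 1]])
    \<and> (\<exists>!A. is_minimal_relations_matrix (R4_gens n) A)"
proof (rule R4_minimal_relations)
  \<comment> \<open>With this bound the signs follow by linear arithmetic in \<open>m\<close> and
    \<open>m^2\<close>, or from the signs of the factors where an entry is given as a
    product.\<close>
  have "m \<le> m^2" using assms(1) by (simp add: power2_eq_square)
  with assms(1) show "- 32 * m * (5 * m - 1) < 0"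
    "- 2 * m * (35 * m + 1) < 0"
    "- 10 * m * (15 * m + 1) < 0"
    "- (650 * m^2 + 50 * m + 1) < 0"
    "- (80 * m^2 + 20 * m + 1) < 0"
    "- 16 * (40 * m^2 + 12 * m + 1) < 0"
    by - (linarith | rule mult_neg_pos, linarith, linarith)+
qed (unfold n, algebra+)

lemma R4_plus_3:
  fixes m n :: int
  assumes "1 \<le> m" and n: "n = 20 * m + 3"
  shows "is_minimal_relations_matrix (R4_gens n)
       (vector [vector [530 * m^2 + 178 * m + 15, - 16 * (10 * m^2 - 6 * m - 1), - (370 * m^2 + 94 * m + 6)],
               vector [- (60 * m^2 + 16 * m + 1), 16 * (20 * m^2 + 8 * m + 1), - (260 * m^2 + 72 * m + 5)],
               vector [- (470 * m^2 + 162 * m + 14), - 32 * (5 * m^2 + 7 * m + 1), 630 * m^2 + 166 * m + 11]])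
    \<and> (\<exists>!A. is_minimal_relations_matrix (R4_gens n) A)"
proof (rule R4_minimal_relations)
  have "m \<le> m^2" using assms(1) by (simp add: power2_eq_square)
  with assms(1) show "- 16 * (10 * m^2 - 6 * m - 1) < 0"
    "- (370 * m^2 + 94 * m + 6) < 0"
    "- (60 * m^2 + 16 * m + 1) < 0"
    "- (260 * m^2 + 72 * m + 5) < 0"
    "- (470 * m^2 + 162 * m + 14) < 0"
    "- 32 * (5 * m^2 + 7 * m + 1) < 0"
    by - (linarith | rule mult_neg_pos, linarith, linarith)+
qed (unfold n, algebra+)

lemma R4_plus_5:
  fixes m n :: int
  assumes "1 \<le> m" and n: "n = 20 * m + 5"
  shows "is_minimal_relations_matrix (R4_gens n)
       (vector [vector [490 * m^2 + 258 * m + 34, - 16 * (30 * m^2 + 10 * m + 1), - (10 * m^2 - 2 * m - 1)],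
               vector [- (320 * m^2 + 164 * m + 21), 16 * (40 * m^2 + 20 * m + 3), - (320 * m^2 + 156 * m + 19)],
               vector [- (170 * m^2 + 94 * m + 13), - 32 * (5 * m^2 + 5 * m + 1), 330 * m^2 + 154 * m + 18]])
    \<and> (\<exists>!A. is_minimal_relations_matrix (R4_gens n) A)"
proof (rule R4_minimal_relations)
  have "m \<le> m^2" using assms(1) by (simp add: power2_eq_square)
  with assms(1) show "- 16 * (30 * m^2 + 10 * m + 1) < 0"
    "- (10 * m^2 - 2 * m - 1) < 0"
    "- (320 * m^2 + 164 * m + 21) < 0"
    "- (320 * m^2 + 156 * m + 19) < 0"
    "- (170 * m^2 + 94 * m + 13) < 0"
    "- 32 * (5 * m^2 + 5 * m + 1) < 0"
    by - (linarith | rule mult_neg_pos, linarith, linarith)+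
qed (unfold n, algebra+)

lemma R4_plus_7:
  fixes m n :: int
  assumes "2 \<le> m" and n: "n = 20 * m + 7"
  shows "is_minimal_relations_matrix (R4_gens n)
       (vector [vector [2 * (565 * m^2 + 417 * m + 77), - 32 * (5 * m^2 - 7 * m - 3), - (970 * m^2 + 638 * m + 105)],
               vector [- (130 * m^2 + 94 * m + 17), 16 * (10 * m^2 + 6 * m + 1), - (30 * m^2 + 22 * m + 4)],
               vector [- (1000 * m^2 + 740 * m + 137), - 16 * (20 * m + 7), 1000 * m^2 + 660 * m + 109]])
    \<and> (\<exists>!A. is_minimal_relations_matrix (R4_gens n) A)"
proof (rule R4_minimal_relations)
  \<comment> \<open>The factor \<open>5 * m^2 - 7 * m - 3\<close> is negative at
    \<open>m = 1\<close>, which is the excluded value \<open>n = 27\<close>.\<close>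
  have "2 * m \<le> m^2" using assms(1) by (simp add: power2_eq_square)
  with assms(1) show "- 32 * (5 * m^2 - 7 * m - 3) < 0"
    "- (970 * m^2 + 638 * m + 105) < 0"
    "- (130 * m^2 + 94 * m + 17) < 0"
    "- (30 * m^2 + 22 * m + 4) < 0"
    "- (1000 * m^2 + 740 * m + 137) < 0"
    "- 16 * (20 * m + 7) < 0"
    by - (linarith | rule mult_neg_pos, linarith, linarith)+
qed (unfold n, algebra+)

lemma R4_plus_9:
  fixes m n :: int
  assumes "1 \<le> m" and n: "n = 20 * m + 9"
  shows "is_minimal_relations_matrix (R4_gens n)
       (vector [vector [430 * m^2 + 402 * m + 94, - 16 * (10 * m^2 + 2 * m - 1), - (270 * m^2 + 230 * m + 49)],
               vector [- (290 * m^2 + 266 * m + 61), 32 * (15 * m^2 + 13 * m + 3), - (190 * m^2 + 170 * m + 38)],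
               vector [- (140 * m^2 + 136 * m + 33), - 16 * (20 * m^2 + 24 * m + 7), 460 * m^2 + 400 * m + 87]])
    \<and> (\<exists>!A. is_minimal_relations_matrix (R4_gens n) A)"
proof (rule R4_minimal_relations)
  have "m \<le> m^2" using assms(1) by (simp add: power2_eq_square)
  with assms(1) show "- 16 * (10 * m^2 + 2 * m - 1) < 0"
    "- (270 * m^2 + 230 * m + 49) < 0"
    "- (290 * m^2 + 266 * m + 61) < 0"
    "- (190 * m^2 + 170 * m + 38) < 0"
    "- (140 * m^2 + 136 * m + 33) < 0"
    "- 16 * (20 * m^2 + 24 * m + 7) < 0"
    by - (linarith | rule mult_neg_pos, linarith, linarith)+
qed (unfold n, algebra+)

text \<open>Replacing \<open>n\<close> by \<open>- n\<close> exchanges the outer generators, so this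
  matrix comes from \<open>R4_plus_9\<close> by changing the sign of \<open>m\<close> and reversing
  the order of rows and columns. The classes \<open>20 * m - 5\<close>, \<open>20 * m - 3\<close>
  and \<open>20 * m - 1\<close> arise in the same way.\<close>

lemma R4_minus_9:
  fixes m n :: int
  assumes "1 \<le> m" and n: "n = 20 * m - 9"
  shows "is_minimal_relations_matrix (R4_gens n)
       (vector [vector [460 * m^2 - 400 * m + 87, - 16 * (20 * m^2 - 24 * m + 7), - (140 * m^2 - 136 * m + 33)],
               vector [- (190 * m^2 - 170 * m + 38), 32 * (15 * m^2 - 13 * m + 3), - (290 * m^2 - 266 * m + 61)],
               vector [- (270 * m^2 - 230 * m + 49), - 16 * (10 * m^2 - 2 * m - 1), 430 * m^2 - 402 * m + 94]])
    \<and> (\<exists>!A. is_minimal_relations_matrix (R4_gens n) A)"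
proof (rule R4_minimal_relations)
  \<comment> \<open>The bound from \<open>(m - 1)^2 \<ge> 0\<close> handles
    \<open>20 * m^2 - 24 * m + 7\<close>, whose linear coefficient is too large for
    \<open>m \<le> m^2\<close>.\<close>
  have "m \<le> m^2" "2 * m - 1 \<le> m^2"
    using assms(1) zero_le_power2[of "m - 1"] by (simp_all add: power2_eq_square algebra_simps)
  with assms(1) show "- 16 * (20 * m^2 - 24 * m + 7) < 0"
    "- (140 * m^2 - 136 * m + 33) < 0"
    "- (190 * m^2 - 170 * m + 38) < 0"
    "- (290 * m^2 - 266 * m + 61) < 0"
    "- (270 * m^2 - 230 * m + 49) < 0"
    "- 16 * (10 * m^2 - 2 * m - 1) < 0"
    by - (linarith | rule mult_neg_pos, linarith, linarith)+
qed (unfold n, algebra+)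

text \<open>The mirror image of \<open>R4_plus_7\<close> contains the positive entry
  \<open>16 * (20 * m - 7)\<close>. Subtracting its row 2 from row 1 and adding it to row 3 restores
  the signs.\<close>

lemma R4_minus_7:
  fixes m n :: int
  assumes "3 \<le> m" and n: "n = 20 * m - 7"
  shows "is_minimal_relations_matrix (R4_gens n)
       (vector [vector [1030 * m^2 - 682 * m + 113, - 32 * (5 * m^2 - 13 * m + 4), - (870 * m^2 - 646 * m + 120)],
               vector [- (30 * m^2 - 22 * m + 4), 16 * (10 * m^2 - 6 * m + 1), - (130 * m^2 - 94 * m + 17)],
               vector [- (1000 * m^2 - 660 * m + 109), - 16 * (20 * m - 7), 1000 * m^2 - 740 * m + 137]])
    \<and> (\<exists>!A. is_minimal_relations_matrix (R4_gens n) A)"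
proof (rule R4_minimal_relations)
  \<comment> \<open>The factor \<open>5 * m^2 - 13 * m + 4\<close> is negative for
    \<open>m = 1\<close> and \<open>m = 2\<close>, the excluded values \<open>n = 13\<close> and
    \<open>n = 33\<close>.\<close>
  have "3 * m \<le> m^2" using assms(1) by (simp add: power2_eq_square)
  with assms(1) show "- 32 * (5 * m^2 - 13 * m + 4) < 0"
    "- (870 * m^2 - 646 * m + 120) < 0"
    "- (30 * m^2 - 22 * m + 4) < 0"
    "- (130 * m^2 - 94 * m + 17) < 0"
    "- (1000 * m^2 - 660 * m + 109) < 0"
    "- 16 * (20 * m - 7) < 0"
    by - (linarith | rule mult_neg_pos, linarith, linarith)+
qed (unfold n, algebra+)

lemma R4_minus_5:
  fixes m n :: int
  assumes "1 \<le> m" and n: "n = 20 * m - 5"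
  shows "is_minimal_relations_matrix (R4_gens n)
       (vector [vector [330 * m^2 - 154 * m + 18, - 32 * (5 * m^2 - 5 * m + 1), - (170 * m^2 - 94 * m + 13)],
               vector [- (320 * m^2 - 156 * m + 19), 16 * (40 * m^2 - 20 * m + 3), - (320 * m^2 - 164 * m + 21)],
               vector [- (10 * m^2 + 2 * m - 1), - 16 * (30 * m^2 - 10 * m + 1), 490 * m^2 - 258 * m + 34]])
    \<and> (\<exists>!A. is_minimal_relations_matrix (R4_gens n) A)"
proof (rule R4_minimal_relations)
  have "m \<le> m^2" using assms(1) by (simp add: power2_eq_square)
  with assms(1) show "- 32 * (5 * m^2 - 5 * m + 1) < 0"
    "- (170 * m^2 - 94 * m + 13) < 0"
    "- (320 * m^2 - 156 * m + 19) < 0"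
    "- (320 * m^2 - 164 * m + 21) < 0"
    "- (10 * m^2 + 2 * m - 1) < 0"
    "- 16 * (30 * m^2 - 10 * m + 1) < 0"
    by - (linarith | rule mult_neg_pos, linarith, linarith)+
qed (unfold n, algebra+)

lemma R4_minus_3:
  fixes m n :: int
  assumes "2 \<le> m" and n: "n = 20 * m - 3"
  shows "is_minimal_relations_matrix (R4_gens n)
       (vector [vector [630 * m^2 - 166 * m + 11, - 32 * (5 * m^2 - 7 * m + 1), - (470 * m^2 - 162 * m + 14)],
               vector [- (260 * m^2 - 72 * m + 5), 16 * (20 * m^2 - 8 * m + 1), - (60 * m^2 - 16 * m + 1)],
               vector [- (370 * m^2 - 94 * m + 6), - 16 * (10 * m^2 + 6 * m - 1), 530 * m^2 - 178 * m + 15]])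
    \<and> (\<exists>!A. is_minimal_relations_matrix (R4_gens n) A)"
proof (rule R4_minimal_relations)
  \<comment> \<open>The factor \<open>5 * m^2 - 7 * m + 1\<close> is negative at
    \<open>m = 1\<close>, the excluded value \<open>n = 17\<close>.\<close>
  have "2 * m \<le> m^2" using assms(1) by (simp add: power2_eq_square)
  with assms(1) show "- 32 * (5 * m^2 - 7 * m + 1) < 0"
    "- (470 * m^2 - 162 * m + 14) < 0"
    "- (260 * m^2 - 72 * m + 5) < 0"
    "- (60 * m^2 - 16 * m + 1) < 0"
    "- (370 * m^2 - 94 * m + 6) < 0"
    "- 16 * (10 * m^2 + 6 * m - 1) < 0"
    by - (linarith | rule mult_neg_pos, linarith, linarith)+
qed (unfold n, algebra+)

lemma R4_minus_1:
  fixes m n :: int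
  assumes "1 \<le> m" and n: "n = 20 * m - 1"
  shows "is_minimal_relations_matrix (R4_gens n)
       (vector [vector [720 * m^2 - 52 * m + 1, - 16 * (40 * m^2 - 12 * m + 1), - (80 * m^2 - 20 * m + 1)],
               vector [- (650 * m^2 - 50 * m + 1), 16 * (50 * m^2 - 10 * m + 1), - 10 * m * (15 * m - 1)],
               vector [- 2 * m * (35 * m - 1), - 32 * m * (5 * m + 1), 230 * m^2 - 30 * m + 1]])
    \<and> (\<exists>!A. is_minimal_relations_matrix (R4_gens n) A)"
proof (rule R4_minimal_relations)
  have "m \<le> m^2" using assms(1) by (simp add: power2_eq_square)
  with assms(1) show "- 16 * (40 * m^2 - 12 * m + 1) < 0"
    "- (80 * m^2 - 20 * m + 1) < 0"
    "- (650 * m^2 - 50 * m + 1) < 0"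
    "- 10 * m * (15 * m - 1) < 0"
    "- 2 * m * (35 * m - 1) < 0"
    "- 32 * m * (5 * m + 1) < 0"
    by - (linarith | rule mult_neg_pos, linarith, linarith)+
qed (unfold n, algebra+)

section \<open>Assembly of the ten residue classes\<close>

theorem mainTheorem8:
  fixes n :: int
  assumes "odd n" and "5 \<le> n" and "n \<notin> {5, 7, 9, 13, 17, 27, 33}"
  shows "(\<exists>m.
      (1 \<le> m \<and> n \<in> {20 * m + 1, 20 * m + 3, 20 * m + 5, 20 * m + 9,
                        20 * m - 9, 20 * m - 5, 20 * m - 1}) \<or>
      (2 \<le> m \<and> n \<in> {20 * m + 7, 20 * m - 3}) \<or>
      (3 \<le> m \<and> n = 20 * m - 7)) \<and>
    (\<exists>!A. is_minimal_relations_matrix (R4_gens n) A) \<and>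
    (\<forall>m\<ge>1. n = 20 * m + 1 \<longrightarrow>
       is_minimal_relations_matrix (R4_gens n)
       (vector [vector [230 * m^2 + 30 * m + 1, - 32 * m * (5 * m - 1), - 2 * m * (35 * m + 1)],
               vector [- 10 * m * (15 * m + 1), 16 * (50 * m^2 + 10 * m + 1), - (650 * m^2 + 50 * m + 1)],
               vector [- (80 * m^2 + 20 * m + 1), - 16 * (40 * m^2 + 12 * m + 1), 720 * m^2 + 52 * m + 1]])) \<and>
    (\<forall>m\<ge>1. n = 20 * m + 3 \<longrightarrow>
       is_minimal_relations_matrix (R4_gens n)
       (vector [vector [530 * m^2 + 178 * m + 15, - 16 * (10 * m^2 - 6 * m - 1), - (370 * m^2 + 94 * m + 6)],
               vector [- (60 * m^2 + 16 * m + 1), 16 * (20 * m^2 + 8 * m + 1), - (260 * m^2 + 72 * m + 5)],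
               vector [- (470 * m^2 + 162 * m + 14), - 32 * (5 * m^2 + 7 * m + 1), 630 * m^2 + 166 * m + 11]])) \<and>
    (\<forall>m\<ge>1. n = 20 * m + 5 \<longrightarrow>
       is_minimal_relations_matrix (R4_gens n)
       (vector [vector [490 * m^2 + 258 * m + 34, - 16 * (30 * m^2 + 10 * m + 1), - (10 * m^2 - 2 * m - 1)],
               vector [- (320 * m^2 + 164 * m + 21), 16 * (40 * m^2 + 20 * m + 3), - (320 * m^2 + 156 * m + 19)],
               vector [- (170 * m^2 + 94 * m + 13), - 32 * (5 * m^2 + 5 * m + 1), 330 * m^2 + 154 * m + 18]])) \<and>
    (\<forall>m\<ge>2. n = 20 * m + 7 \<longrightarrow>
       is_minimal_relations_matrix (R4_gens n)
       (vector [vector [2 * (565 * m^2 + 417 * m + 77), - 32 * (5 * m^2 - 7 * m - 3), - (970 * m^2 + 638 * m + 105)],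
               vector [- (130 * m^2 + 94 * m + 17), 16 * (10 * m^2 + 6 * m + 1), - (30 * m^2 + 22 * m + 4)],
               vector [- (1000 * m^2 + 740 * m + 137), - 16 * (20 * m + 7), 1000 * m^2 + 660 * m + 109]])) \<and>
    (\<forall>m\<ge>1. n = 20 * m + 9 \<longrightarrow>
       is_minimal_relations_matrix (R4_gens n)
       (vector [vector [430 * m^2 + 402 * m + 94, - 16 * (10 * m^2 + 2 * m - 1), - (270 * m^2 + 230 * m + 49)],
               vector [- (290 * m^2 + 266 * m + 61), 32 * (15 * m^2 + 13 * m + 3), - (190 * m^2 + 170 * m + 38)],
               vector [- (140 * m^2 + 136 * m + 33), - 16 * (20 * m^2 + 24 * m + 7), 460 * m^2 + 400 * m + 87]])) \<and>
    (\<forall>m\<ge>1. n = 20 * m - 9 \<longrightarrow>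
       is_minimal_relations_matrix (R4_gens n)
       (vector [vector [460 * m^2 - 400 * m + 87, - 16 * (20 * m^2 - 24 * m + 7), - (140 * m^2 - 136 * m + 33)],
               vector [- (190 * m^2 - 170 * m + 38), 32 * (15 * m^2 - 13 * m + 3), - (290 * m^2 - 266 * m + 61)],
               vector [- (270 * m^2 - 230 * m + 49), - 16 * (10 * m^2 - 2 * m - 1), 430 * m^2 - 402 * m + 94]])) \<and>
    (\<forall>m\<ge>3. n = 20 * m - 7 \<longrightarrow>
       is_minimal_relations_matrix (R4_gens n)
       (vector [vector [1030 * m^2 - 682 * m + 113, - 32 * (5 * m^2 - 13 * m + 4), - (870 * m^2 - 646 * m + 120)],
               vector [- (30 * m^2 - 22 * m + 4), 16 * (10 * m^2 - 6 * m + 1), - (130 * m^2 - 94 * m + 17)],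
               vector [- (1000 * m^2 - 660 * m + 109), - 16 * (20 * m - 7), 1000 * m^2 - 740 * m + 137]])) \<and>
    (\<forall>m\<ge>1. n = 20 * m - 5 \<longrightarrow>
       is_minimal_relations_matrix (R4_gens n)
       (vector [vector [330 * m^2 - 154 * m + 18, - 32 * (5 * m^2 - 5 * m + 1), - (170 * m^2 - 94 * m + 13)],
               vector [- (320 * m^2 - 156 * m + 19), 16 * (40 * m^2 - 20 * m + 3), - (320 * m^2 - 164 * m + 21)],
               vector [- (10 * m^2 + 2 * m - 1), - 16 * (30 * m^2 - 10 * m + 1), 490 * m^2 - 258 * m + 34]])) \<and>
    (\<forall>m\<ge>2. n = 20 * m - 3 \<longrightarrow>
       is_minimal_relations_matrix (R4_gens n)
       (vector [vector [630 * m^2 - 166 * m + 11, - 32 * (5 * m^2 - 7 * m + 1), - (470 * m^2 - 162 * m + 14)],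
               vector [- (260 * m^2 - 72 * m + 5), 16 * (20 * m^2 - 8 * m + 1), - (60 * m^2 - 16 * m + 1)],
               vector [- (370 * m^2 - 94 * m + 6), - 16 * (10 * m^2 + 6 * m - 1), 530 * m^2 - 178 * m + 15]])) \<and>
    (\<forall>m\<ge>1. n = 20 * m - 1 \<longrightarrow>
       is_minimal_relations_matrix (R4_gens n)
       (vector [vector [720 * m^2 - 52 * m + 1, - 16 * (40 * m^2 - 12 * m + 1), - (80 * m^2 - 20 * m + 1)],
               vector [- (650 * m^2 - 50 * m + 1), 16 * (50 * m^2 - 10 * m + 1), - 10 * m * (15 * m - 1)],
               vector [- 2 * m * (35 * m - 1), - 32 * m * (5 * m + 1), 230 * m^2 - 30 * m + 1]]))"
proof -
  \<comment> \<open>The ten forms are the odd residues modulo 20. The excluded \<open>n\<close> are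
    those whose \<open>m\<close> falls below its range: 5, 7 and 9 have \<open>m = 0\<close>, and
    13, 17, 27 and 33 lie in the classes with a larger lower bound.\<close>
  have range: "\<exists>m.
      (1 \<le> m \<and> n \<in> {20 * m + 1, 20 * m + 3, 20 * m + 5, 20 * m + 9,
                        20 * m - 9, 20 * m - 5, 20 * m - 1}) \<or>
      (2 \<le> m \<and> n \<in> {20 * m + 7, 20 * m - 3}) \<or>
      (3 \<le> m \<and> n = 20 * m - 7)"
    using assms by (simp only: insert_iff empty_iff) presburger
  note R4 = R4_plus_1 R4_plus_3 R4_plus_5 R4_plus_7 R4_plus_9
    R4_minus_9 R4_minus_7 R4_minus_5 R4_minus_3 R4_minus_1
  have unique: "\<exists>!A. is_minimal_relations_matrix (R4_gens n) A"
    using range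
    by - (elim exE disjE conjE insertE emptyE; (rule R4[THEN conjunct2], assumption, assumption))
  show ?thesis
    by (intro conjI allI impI range unique; (rule R4[THEN conjunct1], assumption, assumption))
qed

end
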